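(* Let $E$ be a real separable Banach space and let $N$ and $G$ be Lévy spectral measures on $E$ with finite logarithmic moments on the sets $\{x:\|x\|>c\}$, $c>0$. Then $$\int_{(0,\infty)}N(e^sA)\,ds+N(A)=\int_{(0,\infty)}G(e^sA)\,ds\quad\text{for all }A\in\mathcal B_0$$ if and only if $$N(A)=\int_{(0,1)}G(t^{-1}A)\,dt\quad\text{for all }A\in\mathcal B_0.$$
   Context: $\mathcal B_0$ denotes the Borel subsets of $E\setminus\{0\}$; for $r>0$, $rA=\{rx:x\in A\}$. A Lévy spectral measure on $E$ is a Borel measure $M$ on $E\setminus\{0\}$ that occurs in the Lévy–Khintchine representation of some infinitely divisible probability measure $\mu$ on $E$, i.e. $\hat\mu(y)=\exp\big(i\langle y,a\rangle-\tfrac12\langle Ry,y\rangle+\int_{E\setminus\{0\}}[e^{i\langle y,x\rangle}-1-i\langle y,x\rangle1_{\|x\|\le1}(x)]M(dx)\big)$, $y\in E'$, for some $a\in E$ and Gaussian covariance operator $R$. $M$ has finite logarithmic moment on $\{\|x\|>c\}$ if $\int_{\{\|x\|>c\}}\log(1+\|x\|)\,M(dx)<\infty$. *)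

theory Defs
  imports "HOL-Probability.Probability"
begin

definition punctured_borel :: "'a::real_normed_vector measure" where
  "punctured_borel = restrict_space borel (- {0})"

definition charfun :: "'a::real_normed_vector measure \<Rightarrow> ('a \<Rightarrow>\<^sub>L real) \<Rightarrow> complex" where
  "charfun \<mu> y = (CLINT x|\<mu>. iexp (y x))"

definition borel_prob :: "'a::real_normed_vector measure \<Rightarrow> bool" where
  "borel_prob \<mu> \<longleftrightarrow> prob_space \<mu> \<and> sets \<mu> = sets borel"

text \<open>
  The n-fold convolution power of \<open>\<nu>\<close> is written as the law of the sum of n independent
  random variables with law \<open>\<nu>\<close>, since the library's convolution is restricted to
  Euclidean spaces.
\<close>

definition infinitely_divisible :: "'a::{banach, second_countable_topology} measure \<Rightarrow> bool" where
  "infinitely_divisible \<mu> \<longleftrightarrow> borel_prob \<mu> \<and>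
     (\<forall>n::nat. n \<ge> 1 \<longrightarrow> (\<exists>\<nu>. borel_prob \<nu> \<and>
        \<mu> = distr (Pi\<^sub>M {..<n} (\<lambda>_. \<nu>)) borel (\<lambda>\<omega>. \<Sum>i<n. \<omega> i)))"

text \<open>Degenerate normal laws (point masses at the origin) count as Gaussian.\<close>

definition centered_gaussian :: "'a::{banach, second_countable_topology} measure \<Rightarrow> bool" where
  "centered_gaussian \<gamma> \<longleftrightarrow> borel_prob \<gamma> \<and>
     (\<forall>y :: 'a \<Rightarrow>\<^sub>L real.
        distr \<gamma> borel (blinfun_apply y) = return borel 0 \<or>
        (\<exists>\<sigma>>0. distr \<gamma> borel (blinfun_apply y) = density lborel (normal_density 0 \<sigma>)))"

definition gaussian_covariance ::
    "(('a::{banach, second_countable_topology} \<Rightarrow>\<^sub>L real) \<Rightarrow>\<^sub>L 'a) \<Rightarrow> bool" where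
  "gaussian_covariance R \<longleftrightarrow>
     (\<exists>\<gamma>. centered_gaussian \<gamma> \<and> (\<forall>y z :: 'a \<Rightarrow>\<^sub>L real. z (R y) = (LINT x|\<gamma>. y x * z x)))"

definition levy_integrand :: "('a::real_normed_vector \<Rightarrow>\<^sub>L real) \<Rightarrow> 'a \<Rightarrow> complex" where
  "levy_integrand y x =
     iexp (y x) - 1 - \<i> * complex_of_real (y x) * indicator {x. norm x \<le> 1} x"

text \<open>
  Integrability is part of the definition: the integral in the exponent has to exist, whereas
  the Bochner integral of a non-integrable function is 0 by convention.
\<close>

definition levy_spectral_measure :: "'a::{banach, second_countable_topology} measure \<Rightarrow> bool" where
  "levy_spectral_measure M \<longleftrightarrow> sets M = sets punctured_borel \<and>
     (\<exists>\<mu> (a :: 'a) R. infinitely_divisible \<mu> \<and> gaussian_covariance R \<and>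
        (\<forall>y :: 'a \<Rightarrow>\<^sub>L real. integrable M (levy_integrand y) \<and>
           charfun \<mu> y =
             exp (\<i> * complex_of_real (y a) - complex_of_real (y (R y)) / 2
                  + (CLINT x|M. levy_integrand y x))))"

definition finite_log_moment :: "'a::real_normed_vector measure \<Rightarrow> real \<Rightarrow> bool" where
  "finite_log_moment M c \<longleftrightarrow>
     (\<integral>\<^sup>+x\<in>{x. norm x > c}. ennreal (ln (1 + norm x)) \<partial>M) < \<infinity>"

end

theory Submission
  imports Defs
begin

text \<open>
  Along the dilation flow a measure becomes a function on the line: put
  \<open>n(s) = N(e\<^sup>s A)\<close> and \<open>g(s) = G(e\<^sup>s A)\<close>, so that replacing \<open>A\<close> by \<open>e\<^sup>r A\<close> translates
  both. Write \<open>(If)(r) = \<integral>\<^sub>0\<^sup>\<infinity> f(r+s) ds\<close> for the tail integral and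
  \<open>(Jf)(r) = \<integral>\<^sub>0\<^sup>\<infinity> e\<^sup>-\<^sup>s f(r+s) ds\<close> for the average over an exponential time. After
  \<open>t = e\<^sup>-\<^sup>s\<close> (\<open>unit_interval_average_eq_exponential_average\<close>) the theorem says that
  \<open>In + n = Ig\<close> if and only if \<open>n = Jg\<close>. Differentiating, with \<open>D = d/dr\<close>, suggests why: the first equation becomes
  \<open>(1 - D) n = g\<close>, and \<open>J\<close> inverts \<open>1 - D\<close>. In integrated form,
  Tonelli's theorem gives \<open>JI + J = I\<close> and \<open>IJ = JI\<close> on all non-negative measurable functions
  (\<open>exponential_average_of_tail\<close>, \<open>tail_of_exponential_average\<close>).

  If \<open>n = Jg\<close>, then \<open>In + n = IJg + Jg = Ig\<close>. Conversely, applying \<open>J\<close> to \<open>In + n = Ig\<close>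
  gives \<open>In = JIg\<close>, hence \<open>In + Jg = Ig = In + n\<close>, and \<open>n = Jg\<close> follows by cancelling \<open>In\<close>.
  The cancellation needs \<open>In\<close> to be finite. For \<open>A\<close> at positive distance \<open>c\<close> from the origin
  this is what the logarithmic moment provides (\<open>log_tail_integral_finite\<close>): a point \<open>x\<close> stays
  in \<open>e\<^sup>s A\<close> only while \<open>s < log (\<parallel>x\<parallel> / c)\<close>. A general \<open>A\<close> is exhausted from within by
  such sets. The logarithmic moments also make both measures sigma-finite, as Tonelli requires.
\<close>

section \<open>Tail integrals on the half-line\<close>

lemma exponential_mass_interval:
  fixes w :: real
  assumes "w > 0"
  shows "(\<integral>\<^sup>+u\<in>{0<..<w}. ennreal (exp (- u)) \<partial>lborel) = ennreal (1 - exp (- w))"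
proof -
  have "(\<integral>\<^sup>+u\<in>{0<..<w}. ennreal (exp (- u)) \<partial>lborel)
      = (\<integral>\<^sup>+u. ennreal (exp (- u)) * indicator {0..w} u \<partial>lborel)"
    by (intro nn_integral_cong_AE AE_I[where N = "{0, w}"])
       (auto simp: indicator_def emeasure_lborel_countable split: if_splits)
  also have "\<dots> = ennreal ((- exp (- w)) - (- exp (- 0)))"
    by (rule nn_integral_FTC_Icc) (use assms in \<open>auto intro!: derivative_eq_intros\<close>)
  finally show ?thesis by simp
qed

lemma nn_integral_translate_half_line:
  fixes f :: "real \<Rightarrow> ennreal"
  assumes [measurable]: "f \<in> borel_measurable borel"
  shows "(\<integral>\<^sup>+s\<in>{0<..}. f (u + s) \<partial>lborel) = (\<integral>\<^sup>+w\<in>{u<..}. f w \<partial>lborel)"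
  by (subst nn_integral_real_affine[where c = 1 and t = u])
     (auto simp: indicator_def intro!: nn_integral_cong)

text \<open>
  The identity \<open>JI + J = I\<close>, evaluated at 0: exchanging the integrals, \<open>JI\<close> gives the point \<open>w\<close> the
  exponential mass \<open>1 - e\<^sup>-\<^sup>w\<close> of \<open>(0, w)\<close>, and \<open>J\<close> contributes the missing \<open>e\<^sup>-\<^sup>w\<close>.
\<close>

lemma exponential_average_of_tail:
  fixes f :: "real \<Rightarrow> ennreal"
  assumes [measurable]: "f \<in> borel_measurable borel"
  shows "(\<integral>\<^sup>+u\<in>{0<..}. ennreal (exp (- u)) * (\<integral>\<^sup>+s\<in>{0<..}. f (u + s) \<partial>lborel) \<partial>lborel)
           + (\<integral>\<^sup>+s\<in>{0<..}. ennreal (exp (- s)) * f s \<partial>lborel)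
         = (\<integral>\<^sup>+s\<in>{0<..}. f s \<partial>lborel)"
proof -
  have "(\<integral>\<^sup>+u\<in>{0<..}. ennreal (exp (- u)) * (\<integral>\<^sup>+s\<in>{0<..}. f (u + s) \<partial>lborel) \<partial>lborel)
      = (\<integral>\<^sup>+u. (\<integral>\<^sup>+w. ennreal (exp (- u)) * f w * indicator {0<..} u * indicator {u<..} w
           \<partial>lborel) \<partial>lborel)"
    unfolding nn_integral_translate_half_line[OF assms]
  proof (intro nn_integral_cong)
    fix u :: real
    have "ennreal (exp (- u)) * (\<integral>\<^sup>+w\<in>{u<..}. f w \<partial>lborel) * indicator {0<..} u
        = (ennreal (exp (- u)) * indicator {0<..} u) * (\<integral>\<^sup>+w\<in>{u<..}. f w \<partial>lborel)"
      by (simp add: mult_ac)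
    also have "\<dots> = (\<integral>\<^sup>+w. (ennreal (exp (- u)) * indicator {0<..} u) * (f w * indicator {u<..} w) \<partial>lborel)"
      by (rule nn_integral_cmult[symmetric]) measurable
    finally show "ennreal (exp (- u)) * (\<integral>\<^sup>+w\<in>{u<..}. f w \<partial>lborel) * indicator {0<..} u
        = (\<integral>\<^sup>+w. ennreal (exp (- u)) * f w * indicator {0<..} u * indicator {u<..} w \<partial>lborel)"
      by (simp add: mult_ac)
  qed
  also have "\<dots> = (\<integral>\<^sup>+w. (\<integral>\<^sup>+u. ennreal (exp (- u)) * f w * indicator {0<..} u * indicator {u<..} w
           \<partial>lborel) \<partial>lborel)"
    by (rule lborel_pair.Fubini') (unfold indicator_def of_bool_def greaterThan_iff, measurable)
  also have "\<dots> = (\<integral>\<^sup>+w\<in>{0<..}. ennreal (1 - exp (- w)) * f w \<partial>lborel)"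
  proof (intro nn_integral_cong)
    fix w :: real
    have "(\<integral>\<^sup>+u. ennreal (exp (- u)) * f w * indicator {0<..} u * indicator {u<..} w \<partial>lborel)
        = (\<integral>\<^sup>+u. ennreal (exp (- u)) * indicator {0<..<w} u * f w \<partial>lborel)"
      by (intro nn_integral_cong) (auto simp: indicator_def)
    also have "\<dots> = (\<integral>\<^sup>+u\<in>{0<..<w}. ennreal (exp (- u)) \<partial>lborel) * f w"
      by (rule nn_integral_multc) measurable
    also have "\<dots> = ennreal (1 - exp (- w)) * f w * indicator {0<..} w"
      by (cases "w > 0") (simp_all add: exponential_mass_interval)
    finally show "(\<integral>\<^sup>+u. ennreal (exp (- u)) * f w * indicator {0<..} u * indicator {u<..} w
           \<partial>lborel) = ennreal (1 - exp (- w)) * f w * indicator {0<..} w" .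
  qed
  finally have "(\<integral>\<^sup>+u\<in>{0<..}. ennreal (exp (- u)) * (\<integral>\<^sup>+s\<in>{0<..}. f (u + s) \<partial>lborel) \<partial>lborel)
           + (\<integral>\<^sup>+s\<in>{0<..}. ennreal (exp (- s)) * f s \<partial>lborel)
      = (\<integral>\<^sup>+w\<in>{0<..}. ennreal (1 - exp (- w)) * f w \<partial>lborel)
        + (\<integral>\<^sup>+s\<in>{0<..}. ennreal (exp (- s)) * f s \<partial>lborel)" by simp
  also have "\<dots> = (\<integral>\<^sup>+w. ennreal (1 - exp (- w)) * f w * indicator {0<..} w
        + ennreal (exp (- w)) * f w * indicator {0<..} w \<partial>lborel)"
    by (subst nn_integral_add) auto
  also have "\<dots> = (\<integral>\<^sup>+s\<in>{0<..}. f s \<partial>lborel)"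
  proof (intro nn_integral_cong)
    fix w :: real
    show "ennreal (1 - exp (- w)) * f w * indicator {0<..} w
        + ennreal (exp (- w)) * f w * indicator {0<..} w = f w * indicator {0<..} w"
    proof (cases "w > 0")
      case True
      then have "ennreal (1 - exp (- w)) + ennreal (exp (- w)) = 1"
        by (subst ennreal_plus[symmetric]) auto
      then show ?thesis
        using True by (simp add: distrib_right[symmetric])
    qed simp
  qed
  finally show ?thesis .
qed

text \<open>
  The identity \<open>IJ = JI\<close>, evaluated at 0: both operators are convolutions with a measure on the half-line.
\<close>

lemma tail_of_exponential_average:
  fixes f :: "real \<Rightarrow> ennreal"
  assumes [measurable]: "f \<in> borel_measurable borel"
  shows "(\<integral>\<^sup>+s\<in>{0<..}. (\<integral>\<^sup>+u\<in>{0<..}. ennreal (exp (- u)) * f (s + u) \<partial>lborel) \<partial>lborel)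
       = (\<integral>\<^sup>+u\<in>{0<..}. ennreal (exp (- u)) * (\<integral>\<^sup>+s\<in>{0<..}. f (u + s) \<partial>lborel) \<partial>lborel)"
proof -
  have "(\<integral>\<^sup>+s\<in>{0<..}. (\<integral>\<^sup>+u\<in>{0<..}. ennreal (exp (- u)) * f (s + u) \<partial>lborel) \<partial>lborel)
      = (\<integral>\<^sup>+s. (\<integral>\<^sup>+u. ennreal (exp (- u)) * f (s + u) * indicator {0<..} u * indicator {0<..} s
           \<partial>lborel) \<partial>lborel)"
    by (intro nn_integral_cong nn_integral_multc[symmetric]) measurable
  also have "\<dots> = (\<integral>\<^sup>+u. (\<integral>\<^sup>+s. ennreal (exp (- u)) * f (s + u) * indicator {0<..} u * indicator {0<..} s
           \<partial>lborel) \<partial>lborel)"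
    by (rule lborel_pair.Fubini') measurable
  also have "\<dots> = (\<integral>\<^sup>+u\<in>{0<..}. ennreal (exp (- u)) * (\<integral>\<^sup>+s\<in>{0<..}. f (u + s) \<partial>lborel) \<partial>lborel)"
  proof (intro nn_integral_cong)
    fix u :: real
    have "(\<integral>\<^sup>+s. ennreal (exp (- u)) * f (s + u) * indicator {0<..} u * indicator {0<..} s \<partial>lborel)
        = (\<integral>\<^sup>+s. (ennreal (exp (- u)) * indicator {0<..} u) * (f (u + s) * indicator {0<..} s) \<partial>lborel)"
      by (intro nn_integral_cong) (simp add: mult_ac add_ac)
    also have "\<dots> = (ennreal (exp (- u)) * indicator {0<..} u) * (\<integral>\<^sup>+s\<in>{0<..}. f (u + s) \<partial>lborel)"
      by (rule nn_integral_cmult) measurable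
    finally show "(\<integral>\<^sup>+s. ennreal (exp (- u)) * f (s + u) * indicator {0<..} u * indicator {0<..} s \<partial>lborel)
        = ennreal (exp (- u)) * (\<integral>\<^sup>+s\<in>{0<..}. f (u + s) \<partial>lborel) * indicator {0<..} u"
      by (simp add: mult_ac)
  qed
  finally show ?thesis .
qed

text \<open>
  The increasing substitution \<open>t = e\<^sup>x\<close> is made on the compact intervals \<open>[-n-1, 0]\<close>;
  monotone convergence and the reflection \<open>x = -s\<close> finish the argument. Extended values of
  \<open>h\<close> are allowed since the dilated sets may have infinite measure.
\<close>

lemma nn_integral_exp_substitution:
  fixes h :: "real \<Rightarrow> ennreal"
  assumes [measurable]: "h \<in> borel_measurable borel"
  shows "(\<integral>\<^sup>+t\<in>{0<..<1}. h t \<partial>lborel)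
       = (\<integral>\<^sup>+s\<in>{0<..}. ennreal (exp (- s)) * h (exp (- s)) \<partial>lborel)"
proof -
  define k where "k t = h t * indicator {0<..<1} t" for t
  have [measurable]: "k \<in> borel_measurable borel"
    unfolding k_def by measurable
  have piece: "(\<integral>\<^sup>+t. k t * indicator {exp (- real (Suc n))..exp 0} t \<partial>lborel)
     = (\<integral>\<^sup>+x. k (exp x) * ennreal (exp x) * indicator {- real (Suc n)..0} x \<partial>lborel)" for n
    by (rule nn_integral_substitution_aux)
       (auto intro!: derivative_eq_intros continuous_intros)
  have "(SUP n. (\<integral>\<^sup>+t. k t * indicator {exp (- real (Suc n))..exp 0} t \<partial>lborel)) = (\<integral>\<^sup>+t. k t \<partial>lborel)"
  proof (subst nn_integral_monotone_convergence_SUP[symmetric])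
    show "(\<integral>\<^sup>+t. (SUP n. k t * indicator {exp (- real (Suc n))..exp 0} t) \<partial>lborel) = (\<integral>\<^sup>+t. k t \<partial>lborel)"
    proof (intro nn_integral_cong antisym SUP_least)
      fix t :: real
      show "k t \<le> (SUP n. k t * indicator {exp (- real (Suc n))..exp 0} t)"
      proof (cases "0 < t \<and> t < 1")
        case True
        obtain n where "- ln t \<le> real n" using real_arch_simple by blast
        then have "- real (Suc n) \<le> ln t" by simp
        then have "exp (- real (Suc n)) \<le> t" using True by (metis exp_le_cancel_iff exp_ln)
        then show ?thesis using True by (intro SUP_upper2[of n]) auto
      qed (auto simp: k_def)
    qed (auto simp: indicator_def)
  next
    show "incseq (\<lambda>n t. k t * indicator {exp (- real (Suc n))..exp 0} t)"
    proof (intro incseq_SucI le_funI mult_left_mono)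
      fix n and t :: real
      have "exp (- real (Suc (Suc n))) \<le> exp (- real (Suc n))" by simp
      then have "{exp (- real (Suc n))..exp 0} \<subseteq> {exp (- real (Suc (Suc n)))..exp (0::real)}"
        by (intro atLeastatMost_subset_iff[THEN iffD2]) blast
      then show "(indicator {exp (- real (Suc n))..exp 0} t :: ennreal)
          \<le> indicator {exp (- real (Suc (Suc n)))..exp 0} t"
        by (intro indicator_leI) blast
    qed simp
  qed auto
  moreover have "(SUP n. (\<integral>\<^sup>+x. k (exp x) * ennreal (exp x) * indicator {- real (Suc n)..0} x \<partial>lborel))
      = (\<integral>\<^sup>+x. k (exp x) * ennreal (exp x) \<partial>lborel)"
  proof (subst nn_integral_monotone_convergence_SUP[symmetric])
    show "(\<integral>\<^sup>+x. (SUP n. k (exp x) * ennreal (exp x) * indicator {- real (Suc n)..0} x) \<partial>lborel)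
        = (\<integral>\<^sup>+x. k (exp x) * ennreal (exp x) \<partial>lborel)"
    proof (intro nn_integral_cong antisym SUP_least)
      fix x :: real
      show "k (exp x) * ennreal (exp x)
          \<le> (SUP n. k (exp x) * ennreal (exp x) * indicator {- real (Suc n)..0} x)"
      proof (cases "x < 0")
        case True
        obtain n where "- x \<le> real n" using real_arch_simple by blast
        then show ?thesis using True by (intro SUP_upper2[of n]) auto
      qed (auto simp: k_def)
    qed (auto simp: indicator_def)
  qed (auto simp: incseq_def le_fun_def indicator_def)
  ultimately have "(\<integral>\<^sup>+t. k t \<partial>lborel) = (\<integral>\<^sup>+x. k (exp x) * ennreal (exp x) \<partial>lborel)"
    using piece by simp
  also have "\<dots> = (\<integral>\<^sup>+s. k (exp (- s)) * ennreal (exp (- s)) \<partial>lborel)"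
    by (subst nn_integral_real_affine[where c = "- 1" and t = 0]) auto
  finally show ?thesis
    by (simp add: k_def indicator_def mult_ac if_distrib cong: if_cong)
qed

section \<open>Dilations of measures on the punctured space\<close>

lemma sets_punctured_borel_iff: "A \<in> sets punctured_borel \<longleftrightarrow> A \<in> sets borel \<and> 0 \<notin> A"
  for A :: "'a::real_normed_vector set"
  by (auto simp: punctured_borel_def sets_restrict_space_iff)

lemma measurable_ident_punctured_borel:
  fixes M :: "'a::real_normed_vector measure"
  assumes "sets M = sets punctured_borel"
  shows "(\<lambda>x. x) \<in> measurable M borel"
  by (subst measurable_cong_sets[OF assms refl])
    (auto simp: punctured_borel_def intro!: measurable_restrict_space1)

lemma scaleR_image_eq_vimage:
  fixes A :: "'a::real_vector set"
  assumes "r \<noteq> 0"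
  shows "(*\<^sub>R) r ` A = (*\<^sub>R) (inverse r) -` A"
proof -
  have "x \<in> (*\<^sub>R) r ` A" if "inverse r *\<^sub>R x \<in> A" for x
    using imageI[OF that, of "(*\<^sub>R) r"] assms by simp
  then show ?thesis using assms by auto
qed

lemma scaleR_image_in_punctured_borel:
  fixes A :: "'a::{banach, second_countable_topology} set"
  assumes "A \<in> sets punctured_borel" "r \<noteq> 0"
  shows "(*\<^sub>R) r ` A \<in> sets punctured_borel"
proof -
  have [measurable]: "A \<in> sets borel" using assms by (simp add: sets_punctured_borel_iff)
  have "(*\<^sub>R) (inverse r) -` A \<inter> space borel \<in> sets borel"
    by (rule measurable_sets[OF _ \<open>A \<in> sets borel\<close>]) measurable
  then show ?thesis using assms
    by (auto simp: sets_punctured_borel_iff scaleR_image_eq_vimage)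
qed

lemma scaleR_exp_image_image:
  "(*\<^sub>R) (exp s) ` ((*\<^sub>R) (exp u) ` A) = (*\<^sub>R) (exp (u + s)) ` (A :: 'a::real_vector set)"
  by (simp add: image_image exp_add mult.commute)

text \<open>
  On \<open>{\<parallel>x\<parallel> > c}\<close> the integrand \<open>log (1 + \<parallel>x\<parallel>)\<close> is at least \<open>log (1 + c) > 0\<close>, so this set
  has finite measure; the sets with \<open>c = 1/(n+1)\<close> exhaust the punctured space.
\<close>

lemma sigma_finite_if_finite_log_moment:
  fixes M :: "'a::{banach, second_countable_topology} measure"
  assumes sets_M: "sets M = sets punctured_borel" and "\<forall>c>0. finite_log_moment M c"
  shows "sigma_finite_measure M"
proof
  have space_M: "space M = - {0}"
    using sets_eq_imp_space_eq[OF sets_M] by (simp add: punctured_borel_def space_restrict_space)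
  define B where "B n = {x::'a. norm x > 1 / real (Suc n)}" for n
  have B_sets: "B n \<in> sets M" for n
    unfolding sets_M sets_punctured_borel_iff B_def by simp
  have B_fin: "emeasure M (B n) \<noteq> \<infinity>" for n
  proof -
    define c where "c = 1 / real (Suc n)"
    have c: "c > 0" by (simp add: c_def)
    have "ennreal (ln (1 + c)) * emeasure M (B n)
        = (\<integral>\<^sup>+x. ennreal (ln (1 + c)) * indicator (B n) x \<partial>M)"
      using B_sets by (simp add: nn_integral_cmult_indicator)
    also have "\<dots> \<le> (\<integral>\<^sup>+x\<in>{x. norm x > c}. ennreal (ln (1 + norm x)) \<partial>M)"
      using c by (intro nn_integral_mono)
        (auto simp: B_def c_def[symmetric] indicator_def simp del: of_nat_Suc intro!: ennreal_leI)
    also have "\<dots> < \<infinity>"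
      using assms(2) c by (simp add: finite_log_moment_def)
    finally show ?thesis
      using c by (auto simp: ennreal_mult_less_top ennreal_mult_eq_top_iff)
  qed
  have "\<exists>n. x \<in> B n" if "x \<noteq> 0" for x
    using nat_approx_posE[of "norm x"] that by (auto simp: B_def)
  then have "(\<Union>n. B n) = space M"
    by (auto simp: space_M) (auto simp: B_def)
  then show "\<exists>A. countable A \<and> A \<subseteq> sets M \<and> \<Union> A = space M \<and> (\<forall>a\<in>A. emeasure M a \<noteq> \<infinity>)"
    using B_sets B_fin by (intro exI[of _ "range B"]) auto
qed

lemma emeasure_scaleR_exp_eq_nn_integral:
  fixes M :: "'a::{banach, second_countable_topology} measure"
  assumes "sets M = sets punctured_borel" "A \<in> sets punctured_borel"
  shows "emeasure M ((*\<^sub>R) (exp s) ` A) = (\<integral>\<^sup>+x. indicator A (exp (- s) *\<^sub>R x) \<partial>M)"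
proof -
  have "emeasure M ((*\<^sub>R) (exp s) ` A) = (\<integral>\<^sup>+x. indicator ((*\<^sub>R) (exp s) ` A) x \<partial>M)"
    using assms scaleR_image_in_punctured_borel[of A "exp s"] by simp
  also have "\<dots> = (\<integral>\<^sup>+x. indicator A (exp (- s) *\<^sub>R x) \<partial>M)"
    by (intro nn_integral_cong) (simp add: scaleR_image_eq_vimage indicator_def exp_minus)
  finally show ?thesis .
qed

lemma measurable_indicator_scaleR_exp:
  fixes M :: "'a::{banach, second_countable_topology} measure"
  assumes "sets M = sets punctured_borel" "A \<in> sets punctured_borel"
  shows "(\<lambda>(s, x). indicator A (exp (- s) *\<^sub>R x) :: ennreal) \<in> borel_measurable (borel \<Otimes>\<^sub>M M)"
proof -
  have [measurable]: "A \<in> sets borel" using assms by (simp add: sets_punctured_borel_iff)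
  have [measurable]: "snd \<in> measurable (borel \<Otimes>\<^sub>M M) (borel :: 'a measure)"
    using measurable_compose[OF measurable_snd measurable_ident_punctured_borel[OF assms(1)]] .
  show ?thesis by measurable
qed

lemma measurable_emeasure_scaleR_exp:
  fixes M :: "'a::{banach, second_countable_topology} measure"
  assumes "sets M = sets punctured_borel" "sigma_finite_measure M" "A \<in> sets punctured_borel"
  shows "(\<lambda>s. emeasure M ((*\<^sub>R) (exp s) ` A)) \<in> borel_measurable borel"
proof -
  interpret sigma_finite_measure M by fact
  show ?thesis
    unfolding emeasure_scaleR_exp_eq_nn_integral[OF assms(1,3)]
    by (rule borel_measurable_nn_integral[OF measurable_indicator_scaleR_exp[OF assms(1,3)]])
qed

text \<open>
  By Tonelli's theorem the integral is the \<open>M\<close>-integral of the time \<open>s > 0\<close> during which \<open>x\<close> lies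
  in \<open>e\<^sup>s A\<close>. That time is at most \<open>log (\<parallel>x\<parallel> / c)\<close>, and it vanishes if \<open>\<parallel>x\<parallel> \<le> c\<close>.
\<close>

lemma log_tail_integral_finite:
  fixes M :: "'a::{banach, second_countable_topology} measure"
  assumes sets_M: "sets M = sets punctured_borel" and fin: "\<forall>c>0. finite_log_moment M c"
    and A: "A \<in> sets punctured_borel" and c: "0 < c" "\<And>x. x \<in> A \<Longrightarrow> c < norm x"
  shows "(\<integral>\<^sup>+s\<in>{0<..}. emeasure M ((*\<^sub>R) (exp s) ` A) \<partial>lborel) < \<infinity>"
proof -
  interpret sigma_finite_measure M
    using sets_M fin by (rule sigma_finite_if_finite_log_moment)
  interpret P: pair_sigma_finite "lborel :: real measure" M ..
  note [measurable] = measurable_indicator_scaleR_exp[OF sets_M A]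
    measurable_ident_punctured_borel[OF sets_M]
  have [measurable]: "A \<in> sets borel" using A by (simp add: sets_punctured_borel_iff)
  \<comment> \<open>On \<open>\<parallel>x\<parallel> > c\<close> the constant \<open>\<bar>log c\<bar>\<close> is at most \<open>(K - 1) log (1 + \<parallel>x\<parallel>)\<close>.\<close>
  define K where "K = 1 + \<bar>ln c\<bar> / ln (1 + c)"
  have K: "ln (norm x / c) \<le> K * ln (1 + norm x)" if "norm x > c" for x :: 'a
  proof -
    have pos: "ln (1 + c) > 0" using c by simp
    have "ln (1 + c) \<le> ln (1 + norm x)" using c that by simp
    then have "\<bar>ln c\<bar> * ln (1 + c) \<le> \<bar>ln c\<bar> * ln (1 + norm x)" by (rule mult_left_mono) simp
    then have "\<bar>ln c\<bar> \<le> \<bar>ln c\<bar> / ln (1 + c) * ln (1 + norm x)"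
      using pos by (simp add: field_simps)
    moreover have "ln (norm x / c) = ln (norm x) - ln c"
      by (rule ln_divide_pos[OF _ c(1)]) (use c(1) that in linarith)
    moreover have "ln (norm x) \<le> ln (1 + norm x)"
      by (rule ln_mono) (use c(1) that in linarith)+
    ultimately show ?thesis by (simp add: K_def algebra_simps)
  qed
  have "(\<integral>\<^sup>+s\<in>{0<..}. emeasure M ((*\<^sub>R) (exp s) ` A) \<partial>lborel)
      = (\<integral>\<^sup>+s. (\<integral>\<^sup>+x. indicator A (exp (- s) *\<^sub>R x) * indicator {0<..} s \<partial>M) \<partial>lborel)"
    unfolding emeasure_scaleR_exp_eq_nn_integral[OF sets_M A]
    by (intro nn_integral_cong nn_integral_multc[symmetric]) measurable
  also have "\<dots> = (\<integral>\<^sup>+x. (\<integral>\<^sup>+s. indicator A (exp (- s) *\<^sub>R x) * indicator {0<..} s \<partial>lborel) \<partial>M)"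
    by (rule P.Fubini'[symmetric]) measurable
  also have "\<dots> \<le> (\<integral>\<^sup>+x. ennreal K * (ennreal (ln (1 + norm x)) * indicator {x. norm x > c} x) \<partial>M)"
  proof (intro nn_integral_mono)
    fix x :: 'a
    have "(\<integral>\<^sup>+s. indicator A (exp (- s) *\<^sub>R x) * indicator {0<..} s \<partial>lborel)
        \<le> (\<integral>\<^sup>+s. indicator {0..ln (norm x / c)} s * indicator {x. norm x > c} x \<partial>lborel)"
    proof (intro nn_integral_mono)
      fix s :: real
      show "indicator A (exp (- s) *\<^sub>R x) * indicator {0<..} s
          \<le> (indicator {0..ln (norm x / c)} s * indicator {x. norm x > c} x :: ennreal)"
      proof (cases "exp (- s) *\<^sub>R x \<in> A \<and> s > 0")
        case True
        then have "c < exp (- s) * norm x" using c(2)[of "exp (- s) *\<^sub>R x"] by simp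
        then have *: "c * exp s < norm x" by (simp add: exp_minus field_simps)
        have "c * 1 \<le> c * exp s" using True c by (intro mult_left_mono) auto
        with * have "c < norm x" by simp
        moreover have "exp s < norm x / c" using * c by (simp add: field_simps)
        then have "s < ln (norm x / c)"
          by (metis exp_gt_zero less_trans ln_exp ln_less_cancel_iff)
        ultimately show ?thesis using True by simp
      qed auto
    qed
    also have "\<dots> = ennreal (ln (norm x / c)) * indicator {x. norm x > c} x"
      using c by (cases "norm x > c") (simp_all add: field_simps)
    also have "\<dots> \<le> ennreal K * (ennreal (ln (1 + norm x)) * indicator {x. norm x > c} x)"
    proof (cases "norm x > c")
      case True
      have "K \<ge> 0" using c by (simp add: K_def)
      then show ?thesis using K[OF True] True
        by (simp add: ennreal_mult'[symmetric] ennreal_leI)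
    qed simp
    finally show "(\<integral>\<^sup>+s. indicator A (exp (- s) *\<^sub>R x) * indicator {0<..} s \<partial>lborel)
        \<le> ennreal K * (ennreal (ln (1 + norm x)) * indicator {x. norm x > c} x)" .
  qed
  also have "\<dots> = ennreal K * (\<integral>\<^sup>+x\<in>{x. norm x > c}. ennreal (ln (1 + norm x)) \<partial>M)"
    by (rule nn_integral_cmult) measurable
  also have "\<dots> < \<infinity>"
    using fin c(1) by (simp add: finite_log_moment_def ennreal_mult_less_top)
  finally show ?thesis .
qed

section \<open>The equivalence\<close>

lemma unit_interval_average_eq_exponential_average:
  fixes M :: "'a::{banach, second_countable_topology} measure"
  assumes "sets M = sets punctured_borel" "sigma_finite_measure M" "A \<in> sets punctured_borel"
  shows "(\<integral>\<^sup>+t\<in>{0<..<1}. emeasure M ((*\<^sub>R) (inverse t) ` A) \<partial>lborel)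
       = (\<integral>\<^sup>+s\<in>{0<..}. ennreal (exp (- s)) * emeasure M ((*\<^sub>R) (exp s) ` A) \<partial>lborel)"
proof -
  note [measurable] = measurable_emeasure_scaleR_exp[OF assms]
  have "(\<integral>\<^sup>+t\<in>{0<..<1}. emeasure M ((*\<^sub>R) (inverse t) ` A) \<partial>lborel)
      = (\<integral>\<^sup>+t\<in>{0<..<1}. emeasure M ((*\<^sub>R) (exp (- ln t)) ` A) \<partial>lborel)"
    by (intro nn_integral_cong) (auto simp: indicator_def exp_minus)
  also have "\<dots> = (\<integral>\<^sup>+s\<in>{0<..}. ennreal (exp (- s)) * emeasure M ((*\<^sub>R) (exp s) ` A) \<partial>lborel)"
    by (subst nn_integral_exp_substitution) auto
  finally show ?thesis .
qed

text \<open>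
  The algebraic core of the direct implication: \<open>J\<close> is applied to the tail equation along the
  whole orbit \<open>e\<^sup>u A\<close>, and the common finite term \<open>In\<close> is cancelled.
\<close>

lemma emeasure_eq_exponential_average_if_finite_tail:
  fixes N G :: "'a::{banach, second_countable_topology} measure"
  assumes N: "sets N = sets punctured_borel" "sigma_finite_measure N"
    and G: "sets G = sets punctured_borel" "sigma_finite_measure G"
    and A: "A \<in> sets punctured_borel"
    and eq: "\<forall>A\<in>sets punctured_borel.
        (\<integral>\<^sup>+s\<in>{0<..}. emeasure N ((*\<^sub>R) (exp s) ` A) \<partial>lborel) + emeasure N A
          = (\<integral>\<^sup>+s\<in>{0<..}. emeasure G ((*\<^sub>R) (exp s) ` A) \<partial>lborel)"
    and fin: "(\<integral>\<^sup>+s\<in>{0<..}. emeasure N ((*\<^sub>R) (exp s) ` A) \<partial>lborel) < \<infinity>"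
  shows "emeasure N A = (\<integral>\<^sup>+s\<in>{0<..}. ennreal (exp (- s)) * emeasure G ((*\<^sub>R) (exp s) ` A) \<partial>lborel)"
proof -
  define n where "n s = emeasure N ((*\<^sub>R) (exp s) ` A)" for s
  define g where "g s = emeasure G ((*\<^sub>R) (exp s) ` A)" for s
  have [measurable]: "n \<in> borel_measurable borel" "g \<in> borel_measurable borel"
    unfolding n_def g_def using N G A by (auto intro!: measurable_emeasure_scaleR_exp)
  have shifted: "(\<integral>\<^sup>+s\<in>{0<..}. g (u + s) \<partial>lborel) = (\<integral>\<^sup>+s\<in>{0<..}. n (u + s) \<partial>lborel) + n u" for u
    using eq[rule_format, OF scaleR_image_in_punctured_borel[OF A, of "exp u"]]
    by (simp add: scaleR_exp_image_image n_def g_def)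
  let ?Ig = "\<integral>\<^sup>+s\<in>{0<..}. g s \<partial>lborel" and ?In = "\<integral>\<^sup>+s\<in>{0<..}. n s \<partial>lborel"
  let ?Jg = "\<integral>\<^sup>+s\<in>{0<..}. ennreal (exp (- s)) * g s \<partial>lborel"
  have "(\<integral>\<^sup>+u\<in>{0<..}. ennreal (exp (- u)) * (\<integral>\<^sup>+s\<in>{0<..}. g (u + s) \<partial>lborel) \<partial>lborel)
      = (\<integral>\<^sup>+u\<in>{0<..}. ennreal (exp (- u)) * (\<integral>\<^sup>+s\<in>{0<..}. n (u + s) \<partial>lborel) \<partial>lborel)
         + (\<integral>\<^sup>+u\<in>{0<..}. ennreal (exp (- u)) * n u \<partial>lborel)"
    unfolding shifted by (subst nn_integral_add[symmetric]) (auto simp: distrib_left distrib_right)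
  also have "\<dots> = ?In"
    by (rule exponential_average_of_tail) measurable
  finally have "?In + ?Jg = ?Ig"
    using exponential_average_of_tail[of g] by simp
  also have "\<dots> = ?In + n 0" using shifted[of 0] by simp
  finally have "?Jg = n 0"
    using fin by (auto simp: n_def ennreal_add_left_cancel)
  then show ?thesis by (simp add: n_def g_def)
qed

theorem corollary2:
  fixes N G :: "'a::{banach, second_countable_topology} measure"
  assumes "levy_spectral_measure N" and "levy_spectral_measure G"
    and "\<forall>c>0. finite_log_moment N c" and "\<forall>c>0. finite_log_moment G c"
  shows
    "(\<forall>A\<in>sets punctured_borel.
        (\<integral>\<^sup>+s\<in>{0<..}. emeasure N ((*\<^sub>R) (exp s) ` A) \<partial>lborel) + emeasure N A
          = (\<integral>\<^sup>+s\<in>{0<..}. emeasure G ((*\<^sub>R) (exp s) ` A) \<partial>lborel))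
     \<longleftrightarrow>
     (\<forall>A\<in>sets punctured_borel.
        emeasure N A = (\<integral>\<^sup>+t\<in>{0<..<1}. emeasure G ((*\<^sub>R) (inverse t) ` A) \<partial>lborel))"
proof -
  have sets_N: "sets N = sets punctured_borel" and sets_G: "sets G = sets punctured_borel"
    using assms(1,2) by (simp_all add: levy_spectral_measure_def)
  have sf_N: "sigma_finite_measure N" and sf_G: "sigma_finite_measure G"
    using sigma_finite_if_finite_log_moment sets_N sets_G assms(3,4) by blast+
  note G_meas = measurable_emeasure_scaleR_exp[OF sets_G sf_G]
  show ?thesis (is "?tail \<longleftrightarrow> ?average")
  proof
    assume tail: ?tail
    show ?average
    proof
      fix A :: "'a set"
      assume A: "A \<in> sets punctured_borel"
      \<comment> \<open>The tail integral may be infinite for \<open>A\<close> itself, but not for its part outside a ball.\<close>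
      define B where "B k = A \<inter> {x. norm x > 1 / real (Suc k)}" for k
      have B: "B k \<in> sets punctured_borel" for k
        using A by (auto simp: B_def sets_punctured_borel_iff)
      have B_mono: "incseq B"
      proof (rule incseq_SucI)
        fix k
        have "1 / real (Suc (Suc k)) \<le> 1 / real (Suc k)" by (simp add: field_simps)
        then show "B k \<subseteq> B (Suc k)" by (auto simp: B_def)
      qed
      have B_UN: "(\<Union>k. B k) = A"
      proof -
        have "\<exists>k. x \<in> B k" if "x \<in> A" for x
          using nat_approx_posE[of "norm x"] that A by (auto simp: B_def sets_punctured_borel_iff)
        then show ?thesis by (auto simp: B_def)
      qed
      have on_B: "emeasure N (B k)
          = (\<integral>\<^sup>+s\<in>{0<..}. ennreal (exp (- s)) * emeasure G ((*\<^sub>R) (exp s) ` B k) \<partial>lborel)" for k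
        by (rule emeasure_eq_exponential_average_if_finite_tail[OF sets_N sf_N sets_G sf_G B tail])
           (rule log_tail_integral_finite[OF sets_N assms(3) B, of "1 / real (Suc k)"],
             auto simp: B_def)
      have dilate_mono: "incseq (\<lambda>k. (*\<^sub>R) (exp s) ` B k)" for s
        using B_mono by (auto simp: incseq_def)
      have "emeasure N A = (SUP k. emeasure N (B k))"
        using SUP_emeasure_incseq[of B N] B B_mono sets_N by (simp add: B_UN image_subset_iff)
      also have "\<dots> = (\<integral>\<^sup>+s. (SUP k. ennreal (exp (- s)) * emeasure G ((*\<^sub>R) (exp s) ` B k)
                                  * indicator {0<..} s) \<partial>lborel)"
        unfolding on_B
      proof (rule nn_integral_monotone_convergence_SUP[symmetric])
        show "incseq (\<lambda>k s. ennreal (exp (- s)) * emeasure G ((*\<^sub>R) (exp s) ` B k) * indicator {0<..} s)"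
          unfolding incseq_def le_fun_def
          using incseqD[OF dilate_mono] scaleR_image_in_punctured_borel[OF B] sets_G
          by (intro allI impI mult_right_mono mult_left_mono emeasure_mono) auto
        show "(\<lambda>s. ennreal (exp (- s)) * emeasure G ((*\<^sub>R) (exp s) ` B k) * indicator {0<..} s)
            \<in> borel_measurable lborel" for k
          using G_meas[OF B[of k]] by measurable
      qed
      also have "\<dots> = (\<integral>\<^sup>+s\<in>{0<..}. ennreal (exp (- s)) * emeasure G ((*\<^sub>R) (exp s) ` A) \<partial>lborel)"
      proof (intro nn_integral_cong)
        fix s :: real
        have "(SUP k. emeasure G ((*\<^sub>R) (exp s) ` B k)) = emeasure G ((*\<^sub>R) (exp s) ` A)"
          using SUP_emeasure_incseq[of "\<lambda>k. (*\<^sub>R) (exp s) ` B k" G]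
            scaleR_image_in_punctured_borel[OF B, of "exp s"] sets_G dilate_mono[of s]
          by (auto simp: image_UN[symmetric] B_UN)
        then show "(SUP k. ennreal (exp (- s)) * emeasure G ((*\<^sub>R) (exp s) ` B k) * indicator {0<..} s)
            = ennreal (exp (- s)) * emeasure G ((*\<^sub>R) (exp s) ` A) * indicator {0<..} s"
          by (simp add: SUP_mult_left_ennreal[symmetric] SUP_mult_right_ennreal[symmetric])
      qed
      finally show "emeasure N A = (\<integral>\<^sup>+t\<in>{0<..<1}. emeasure G ((*\<^sub>R) (inverse t) ` A) \<partial>lborel)"
        by (simp add: unit_interval_average_eq_exponential_average[OF sets_G sf_G A])
    qed
  next
    assume average: ?average
    show ?tail
    proof
      fix A :: "'a set"
      assume A: "A \<in> sets punctured_borel"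
      define g where "g s = emeasure G ((*\<^sub>R) (exp s) ` A)" for s
      have g: "g \<in> borel_measurable borel"
        unfolding g_def using G_meas[OF A] .
      have N_eq: "emeasure N ((*\<^sub>R) (exp s) ` A)
          = (\<integral>\<^sup>+u\<in>{0<..}. ennreal (exp (- u)) * g (s + u) \<partial>lborel)" for s
      proof -
        have dil: "(*\<^sub>R) (exp s) ` A \<in> sets punctured_borel"
          using scaleR_image_in_punctured_borel[OF A] by simp
        show ?thesis
          using average[rule_format, OF dil]
            unit_interval_average_eq_exponential_average[OF sets_G sf_G dil]
          by (simp add: scaleR_exp_image_image g_def)
      qed
      have N_A: "emeasure N A = (\<integral>\<^sup>+u\<in>{0<..}. ennreal (exp (- u)) * g u \<partial>lborel)"
        using N_eq[of 0] by simp
      have "(\<integral>\<^sup>+s\<in>{0<..}. emeasure N ((*\<^sub>R) (exp s) ` A) \<partial>lborel) + emeasure N A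
          = (\<integral>\<^sup>+s\<in>{0<..}. g s \<partial>lborel)"
        using exponential_average_of_tail[OF g] unfolding N_A
        unfolding N_eq tail_of_exponential_average[OF g] by simp
      then show "(\<integral>\<^sup>+s\<in>{0<..}. emeasure N ((*\<^sub>R) (exp s) ` A) \<partial>lborel) + emeasure N A
          = (\<integral>\<^sup>+s\<in>{0<..}. emeasure G ((*\<^sub>R) (exp s) ` A) \<partial>lborel)"
        by (simp add: g_def)
    qed
  qed
qed

end
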